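(* Let $m\in\mathbb{Z}_{\geq1}$ and $r'\in\mathbb{Z}_{\geq 0}$ be fixed. Let $r\in\{0,\ldots,5\}$ and $k:\mathbb{Z}\to\mathbb{Z}$ be such that $6mk'+r'=6k(k')+r$ for all $k'\in\mathbb{Z}_{\geq0}$. Let $\ell_1,\ell_2:\mathbb{Z}\to\mathbb{Z}$ and set $R(k')=\mathbb{Z}^2\cap\big([0,\ell_1(k')-1]\times[0,\ell_2(k')-1]\big)$. For each $i\in\{0,1,2\}$ and each $\mu\in H_{r+6i}$ let $\psi_\mu:\mathbb{R}^3\to\mathbb{R}^2$ be an affine linear function such that for every $s\in\mathbb{Z}_{\ge1}$ the restriction $\psi_\mu|_{T_s}$ is injective, and such that for every $k'\in\mathbb{Z}_{\ge0}$ the sets $\psi_\mu(T_{k(k')-i})$, for $i\in\{0,1,2\}$ and $\mu\in H_{r+6i}$, are pairwise disjoint with union equal to $R(k')$. Define $\psi:Q_{k(k'),r}\to R(k')$ by $\psi(\mu,\tau)=\psi_\mu(\tau)$. Let $\eta:\mathbb{R}^2\to\{0,\ldots,m-1\}$ be of the form $\eta(x,y)=\alpha x+\beta y+\gamma \bmod m$ with $\alpha,\beta,\gamma\in\mathbb{Z}$. Suppose at least one of the following holds: (i) $\gcd(\alpha,m)=1$ and $m\mid \ell_1(k')$ for all $k'\ge0$; or (ii) $\gcd(\beta,m)=1$ and $m\mid\ell_2(k')$ for all $k'\ge0$. Then for every $k'\ge0$, the function $c=\eta\circ\psi\circ\phi_{k(k'),r}$ on $P(6mk'+r',3)$ takes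 each value $0,1,\ldots,m-1$ exactly $p(6mk'+r',3)/m$ times (in particular $p(6mk'+r',3)\equiv0\pmod m$). Moreover, letting $\delta=(1,0)$ in case (i) and $\delta=(0,1)$ in case (ii), the map $$\lambda\longmapsto(\psi\circ\phi_{k(k'),r})^{-1}\big((\psi\circ\phi_{k(k'),r})(\lambda)+\delta\big),$$ where the addition in the first (resp. second) coordinate is taken modulo $\ell_1(k')$ (resp. $\ell_2(k')$) within $\{0,\ldots,\ell_1(k')-1\}$ (resp. $\{0,\ldots,\ell_2(k')-1\}$), is a permutation of $P(6mk'+r',3)$ all of whose cycles have length $\ell_1(k')$ (resp. $\ell_2(k')$).
   Context: $P(n,3)$ is the set of integer vectors $\lambda=(\lambda_1,\lambda_2,\lambda_3)$ with $\lambda_1+\lambda_2+\lambda_3=n$ and $\lambda_1\ge\lambda_2\ge\lambda_3>0$, and $p(n,3)=\#P(n,3)$. $V_3$ is the $3\times3$ matrix with columns $v_1=(6,0,0)$, $v_2=(3,3,0)$, $v_3=(2,2,2)$. $F_3=\mathbb{Z}^3\cap\{a v_1+b v_2+c v_3 : a,b\in[0,1),\ c\in(0,1]\}$; $H_i=\{\mu\in F_3:\mu_1+\mu_2+\mu_3=i\}$; $T_k=\{v\in\mathbb{Z}^3_{\ge0}:v_1+v_2+v_3=k\}$ (empty for $k<0$). For $k\ge0$, $r\in\{0,\ldots,5\}$: $Q_{k,r}=(H_r\times T_k)\cup(H_{6+r}\times T_{k-1})\cup(H_{12+r}\times T_{k-2})$, and $\phi_{k,r}:P(6k+r,3)\to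 Q_{k,r}$ sends $\lambda$ to the unique pair $(\mu,\tau)$ with $\mu\in F_3$, $\tau\in\mathbb{Z}^3_{\ge0}$, $\lambda=\mu+V_3\tau$ (this is a bijection). *)

theory Defs
  imports
    "HOL-Analysis.Analysis"
    "HOL-Combinatorics.Orbits"
    "HOL-Library.Real_Mod"
begin

text \<open>
  Integer vectors are represented as points of the lattice of integral vectors in real Euclidean
  space, so that \<open>\<int>\<^sup>3\<close> and \<open>\<int>\<^sup>2\<close> are literally subsets of the
  domain and codomain of the affine maps.
\<close>

definition int_lattice :: "(real ^ 'n) set" where
  "int_lattice = {v. \<forall>i. v $ i \<in> \<int>}"

definition P3 :: "int \<Rightarrow> (real ^ 3) set" where
  "P3 n = {v \<in> int_lattice. v $ 1 + v $ 2 + v $ 3 = of_int n \<and>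
             v $ 1 \<ge> v $ 2 \<and> v $ 2 \<ge> v $ 3 \<and> v $ 3 > 0}"

definition p3 :: "int \<Rightarrow> nat" where
  "p3 n = card (P3 n)"

text \<open>The inner vectors are the columns of the matrix.\<close>

definition V3 :: "real ^ 3 ^ 3" where
  "V3 = transpose (vector [vector [6, 0, 0], vector [3, 3, 0], vector [2, 2, 2]])"

definition F3 :: "(real ^ 3) set" where
  "F3 = int_lattice \<inter>
     {a *\<^sub>R column 1 V3 + b *\<^sub>R column 2 V3 + c *\<^sub>R column 3 V3 | a b c.
        a \<in> {0..<1} \<and> b \<in> {0..<1} \<and> c \<in> {0<..1}}"

definition H :: "int \<Rightarrow> (real ^ 3) set" where
  "H i = {\<mu> \<in> F3. \<mu> $ 1 + \<mu> $ 2 + \<mu> $ 3 = of_int i}"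

definition T :: "int \<Rightarrow> (real ^ 3) set" where
  "T k = {v \<in> int_lattice. (\<forall>i. v $ i \<ge> 0) \<and> v $ 1 + v $ 2 + v $ 3 = of_int k}"

definition Q :: "int \<Rightarrow> int \<Rightarrow> ((real ^ 3) \<times> (real ^ 3)) set" where
  "Q k r = H r \<times> T k \<union> H (6 + r) \<times> T (k - 1) \<union> H (12 + r) \<times> T (k - 2)"

definition phi :: "int \<Rightarrow> int \<Rightarrow> real ^ 3 \<Rightarrow> (real ^ 3) \<times> (real ^ 3)" where
  "phi k r = restrict
     (\<lambda>v. THE (\<mu>, \<tau>). \<mu> \<in> F3 \<and> \<tau> \<in> int_lattice \<and> (\<forall>i. \<tau> $ i \<ge> 0) \<and> v = \<mu> + V3 *v \<tau>)
     (P3 (6 * k + r))"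

definition affine_map :: "('a::real_vector \<Rightarrow> 'b::real_vector) \<Rightarrow> bool" where
  "affine_map f \<longleftrightarrow> (\<exists>L b. linear L \<and> (\<forall>x. f x = L x + b))"

definition rect :: "int \<Rightarrow> int \<Rightarrow> (real ^ 2) set" where
  "rect a b = int_lattice \<inter>
     {v. v $ 1 \<in> {0..of_int (a - 1)} \<and> v $ 2 \<in> {0..of_int (b - 1)}}"

definition psiQ :: "(real ^ 3 \<Rightarrow> real ^ 3 \<Rightarrow> real ^ 2) \<Rightarrow> int \<Rightarrow> int \<Rightarrow>
    (real ^ 3) \<times> (real ^ 3) \<Rightarrow> real ^ 2" where
  "psiQ \<psi> k r = restrict (\<lambda>(\<mu>, \<tau>). \<psi> \<mu> \<tau>) (Q k r)"

definition cyclic_add :: "int \<Rightarrow> int \<Rightarrow> real ^ 2 \<Rightarrow> real ^ 2 \<Rightarrow> real ^ 2" where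
  "cyclic_add a b v d = vector [(v $ 1 + d $ 1) rmod of_int a, (v $ 2 + d $ 2) rmod of_int b]"

definition shift_by :: "(real ^ 3) set \<Rightarrow> (real ^ 3 \<Rightarrow> real ^ 2) \<Rightarrow> int \<Rightarrow> int \<Rightarrow> real ^ 2 \<Rightarrow>
    real ^ 3 \<Rightarrow> real ^ 3" where
  "shift_by S f a b d v = inv_into S f (cyclic_add a b (f v) d)"

text \<open>
  Cycles are orbits; for a bijection of a finite set \<open>S\<close> onto itself, \<open>orbit \<sigma> v\<close> is
  the support of the cycle through \<open>v\<close> (fixed points are cycles of length 1).
\<close>

definition permutation_with_cycle_length :: "('a \<Rightarrow> 'a) \<Rightarrow> 'a set \<Rightarrow> int \<Rightarrow> bool" where
  "permutation_with_cycle_length \<sigma> S l \<longleftrightarrow>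
     bij_betw \<sigma> S S \<and> (\<forall>v \<in> S. int (card (orbit \<sigma> v)) = l)"

end

theory Submission imports Defs "HOL-Number_Theory.Cong" begin

text \<open>
  In the basis of columns of \<open>V3\<close> a partition has coordinates
  \<open>(v\<^sub>1 - v\<^sub>2)/6\<close>, \<open>(v\<^sub>2 - v\<^sub>3)/3\<close> and \<open>v\<^sub>3/2\<close>; splitting off integer parts
  (floor, floor, ceiling minus one) gives \<open>\<phi>\<close> and shows that it is bijective. Together with the
  disjointness and covering hypotheses, the composition identifies partitions with the points of
  an integer rectangle. There \<open>\<delta>\<close> rotates each row (or column) through all its points, and since
  \<open>\<alpha>\<close> (or \<open>\<beta>\<close>) is invertible modulo \<open>m\<close>, which divides the side length, each residue is attained
  equally often along every such line.
\<close>

subsection \<open>The decomposition of partitions\<close>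

lemma V3_mult_component:
  "(V3 *v x) $ 1 = 6 * x $ 1 + 3 * x $ 2 + 2 * x $ 3"
  "(V3 *v x) $ 2 = 3 * x $ 2 + 2 * x $ 3"
  "(V3 *v x) $ 3 = 2 * x $ 3"
  by (simp_all add: V3_def matrix_vector_mult_def transpose_def sum_3)

lemma column_V3:
  "column 1 V3 = vector [6, 0, 0]" "column 2 V3 = vector [3, 3, 0]"
  "column 3 V3 = vector [2, 2, 2]"
  by (simp_all add: V3_def column_transpose row_def vec_eq_iff forall_3)

text \<open>The system for \<open>a\<close>, \<open>b\<close>, \<open>c\<close> is triangular, so it
  is solved by the three quotients supplied as witnesses. Membership then becomes linear bounds
  usable by arithmetic.\<close>

lemma mem_F3_iff:
  "\<mu> \<in> F3 \<longleftrightarrow> \<mu> \<in> int_lattice \<and> 0 \<le> \<mu> $ 1 - \<mu> $ 2 \<and> \<mu> $ 1 - \<mu> $ 2 < 6 \<and>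
     0 \<le> \<mu> $ 2 - \<mu> $ 3 \<and> \<mu> $ 2 - \<mu> $ 3 < 3 \<and> 0 < \<mu> $ 3 \<and> \<mu> $ 3 \<le> 2"
proof -
  have "(\<exists>a b c. \<mu> = a *\<^sub>R column 1 V3 + b *\<^sub>R column 2 V3 + c *\<^sub>R column 3 V3 \<and>
           a \<in> {0..<1} \<and> b \<in> {0..<1} \<and> c \<in> {0<..1}) \<longleftrightarrow>
        0 \<le> \<mu> $ 1 - \<mu> $ 2 \<and> \<mu> $ 1 - \<mu> $ 2 < 6 \<and>
        0 \<le> \<mu> $ 2 - \<mu> $ 3 \<and> \<mu> $ 2 - \<mu> $ 3 < 3 \<and> 0 < \<mu> $ 3 \<and> \<mu> $ 3 \<le> 2" (is "?L \<longleftrightarrow> ?R")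
  proof
    assume ?R
    then show ?L
      by - (rule exI[of _ "(\<mu> $ 1 - \<mu> $ 2) / 6"], rule exI[of _ "(\<mu> $ 2 - \<mu> $ 3) / 3"],
          rule exI[of _ "\<mu> $ 3 / 2"], simp add: column_V3 vec_eq_iff forall_3 field_simps)
  qed (auto simp: column_V3)
  then show ?thesis
    unfolding F3_def by blast
qed

text \<open>Each cone coordinate of a point of \<open>F3\<close> ranges over a half-open interval of
  length 1, so two integral shifts leading to the same point differ by less than 1 in each
  coordinate. The triangular shape of \<open>V3\<close> permits back substitution from the third
  coordinate.\<close>

lemma V3_mult_add_unique:
  assumes "\<mu> \<in> F3" "\<mu>' \<in> F3" "\<tau> \<in> int_lattice" "\<tau>' \<in> int_lattice"
    and "\<mu> + V3 *v \<tau> = \<mu>' + V3 *v \<tau>'"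
  shows "\<mu> = \<mu>' \<and> \<tau> = \<tau>'"
proof -
  have eq: "\<mu> $ i + (V3 *v \<tau>) $ i = \<mu>' $ i + (V3 *v \<tau>') $ i" for i
    using arg_cong[OF assms(5), of "\<lambda>x. x $ i"] by simp
  obtain t t' :: "3 \<Rightarrow> int" where t: "\<And>i. \<tau> $ i = of_int (t i)" "\<And>i. \<tau>' $ i = of_int (t' i)"
    using assms(3,4) unfolding int_lattice_def Ints_def by (auto simp: image_iff) metis
  note b = assms(1,2)[unfolded mem_F3_iff]
  note e = eq[of 1] eq[of 2] eq[of 3]
  \<comment> \<open>The third row reads \<open>2 * (t 3 - t' 3)\<close> as a difference of two
    numbers in the interval from 0 (excluded) to 2 (included).\<close>
  have "\<bar>of_int (t 3 - t' 3) :: real\<bar> < 1" using b e by (simp add: V3_mult_component t)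
  then have 3: "t 3 = t' 3" by linarith
  have "\<bar>of_int (t 2 - t' 2) :: real\<bar> < 1" using b e by (simp add: V3_mult_component t 3)
  then have 2: "t 2 = t' 2" by linarith
  have "\<bar>of_int (t 1 - t' 1) :: real\<bar> < 1" using b e by (simp add: V3_mult_component t 3 2)
  then have 1: "t 1 = t' 1" by linarith
  have "\<tau> = \<tau>'" by (simp add: vec_eq_iff forall_3 t 1 2 3)
  with assms(5) show ?thesis by simp
qed

lemma V3_mult_int_lattice: "\<tau> \<in> int_lattice \<Longrightarrow> V3 *v \<tau> \<in> int_lattice"
  by (simp add: int_lattice_def V3_mult_component forall_3)

lemma V3_mult_add_exists:
  assumes "v \<in> P3 n"
  obtains \<mu> \<tau> where "\<mu> \<in> F3" "\<tau> \<in> int_lattice" "\<And>i. \<tau> $ i \<ge> 0" "v = \<mu> + V3 *v \<tau>"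
proof -
  define t1 where "t1 = \<lfloor>(v $ 1 - v $ 2) / 6\<rfloor>"
  define t2 where "t2 = \<lfloor>(v $ 2 - v $ 3) / 3\<rfloor>"
  \<comment> \<open>The third cone coordinate of \<open>F3\<close> lies in an interval open at 0 and
    closed at 1, hence ceiling minus one instead of the floor.\<close>
  define t3 where "t3 = \<lceil>v $ 3 / 2\<rceil> - 1"
  define \<tau> :: "real ^ 3" where "\<tau> = vector [of_int t1, of_int t2, of_int t3]"
  have v: "v \<in> int_lattice" "v $ 1 \<ge> v $ 2" "v $ 2 \<ge> v $ 3" "v $ 3 > 0"
    using assms by (simp_all add: P3_def)
  have \<tau>: "\<tau> \<in> int_lattice"
    by (simp add: \<tau>_def int_lattice_def forall_3)
  have "v - V3 *v \<tau> \<in> int_lattice"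
    using v(1) V3_mult_int_lattice[OF \<tau>] by (simp add: int_lattice_def)
  moreover have "of_int t1 \<le> (v $ 1 - v $ 2) / 6" "(v $ 1 - v $ 2) / 6 < of_int t1 + 1"
    "of_int t2 \<le> (v $ 2 - v $ 3) / 3" "(v $ 2 - v $ 3) / 3 < of_int t2 + 1"
    "of_int t3 < v $ 3 / 2" "v $ 3 / 2 \<le> of_int t3 + 1"
    unfolding t1_def t2_def t3_def by linarith+
  ultimately have "v - V3 *v \<tau> \<in> F3"
    by (simp add: mem_F3_iff V3_mult_component \<tau>_def)
  moreover have "0 \<le> t1" "0 \<le> t2"
    using v by (simp_all add: t1_def t2_def)
  \<comment> \<open>Here the strict inequality \<open>v $ 3 > 0\<close> matters: it makes the
    ceiling at least 1.\<close>
  moreover have "0 \<le> t3"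
    using v by (simp add: t3_def)
  then have "\<tau> $ i \<ge> 0" for i
    using \<open>0 \<le> t1\<close> \<open>0 \<le> t2\<close> exhaust_3[of i] by (auto simp: \<tau>_def)
  ultimately show thesis
    using that[of "v - V3 *v \<tau>" \<tau>] \<tau> by simp
qed

text \<open>Every column of \<open>V3\<close> has coordinate sum 6, and points of \<open>F3\<close>
  have coordinate sum strictly between 0 and 18. Hence only the sums \<open>r\<close>,
  \<open>6 + r\<close> and \<open>12 + r\<close> can occur for \<open>\<mu>\<close>, and each one
  fixes the sum of \<open>\<tau>\<close>.\<close>

lemma mem_Q_iff:
  assumes "r \<in> {0..5}"
  shows "(\<mu>, \<tau>) \<in> Q k r \<longleftrightarrow> \<mu> \<in> F3 \<and> \<tau> \<in> int_lattice \<and> (\<forall>i. \<tau> $ i \<ge> 0) \<and>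
    \<mu> + V3 *v \<tau> \<in> P3 (6 * k + r)" (is "?L \<longleftrightarrow> ?R")
proof
  assume ?L
  then show ?R
    by (auto simp: Q_def H_def T_def P3_def mem_F3_iff V3_mult_component forall_3
        int_lattice_def)
next
  assume R: ?R
  then have ints: "\<And>i. \<mu> $ i \<in> \<int>" "\<And>i. \<tau> $ i \<in> \<int>"
    by (auto simp: int_lattice_def mem_F3_iff)
  then have "\<mu> $ 1 + \<mu> $ 2 + \<mu> $ 3 \<in> \<int>" "\<tau> $ 1 + \<tau> $ 2 + \<tau> $ 3 \<in> \<int>" by auto
  then obtain s t where s: "\<mu> $ 1 + \<mu> $ 2 + \<mu> $ 3 = of_int s"
    and t: "\<tau> $ 1 + \<tau> $ 2 + \<tau> $ 3 = of_int t"
    by (auto elim!: Ints_cases)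
  have "of_int (s + 6 * t) = (of_int (6 * k + r) :: real)"
    using R s t by (auto simp: P3_def V3_mult_component)
  then have e: "s + 6 * t = 6 * k + r"
    by (simp only: of_int_eq_iff)
  have "0 < (of_int s :: real)" "(of_int s :: real) < 18"
    using R s by (auto simp: mem_F3_iff)
  then have "0 < s" "s < 18" by simp_all
  \<comment> \<open>The number \<open>k - t\<close> is the index of the piece of \<open>Q\<close>,
    since \<open>s = r + 6 * (k - t)\<close>.\<close>
  with e assms have "0 \<le> k - t" "k - t \<le> 2"
    by auto
  with e have "s = r \<and> t = k \<or> s = 6 + r \<and> t = k - 1 \<or> s = 12 + r \<and> t = k - 2"
    by presburger
  with R s t show ?L
    by (auto simp: Q_def H_def T_def)
qed

text \<open>Uniqueness of the decomposition turns the definite description in \<open>phi\<close>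
  into an evaluation rule.\<close>

lemma phi_eq:
  assumes "r \<in> {0..5}" "(\<mu>, \<tau>) \<in> Q k r"
  shows "phi k r (\<mu> + V3 *v \<tau>) = (\<mu>, \<tau>)"
proof -
  have *: "\<mu> \<in> F3" "\<tau> \<in> int_lattice" "\<forall>i. \<tau> $ i \<ge> 0" "\<mu> + V3 *v \<tau> \<in> P3 (6 * k + r)"
    using assms mem_Q_iff by auto
  have "(THE (\<mu>', \<tau>'). \<mu>' \<in> F3 \<and> \<tau>' \<in> int_lattice \<and> (\<forall>i. \<tau>' $ i \<ge> 0) \<and>
      \<mu> + V3 *v \<tau> = \<mu>' + V3 *v \<tau>') = (\<mu>, \<tau>)"
    by (rule the_equality) (use * V3_mult_add_unique in auto)
  with *(4) show ?thesis by (simp add: phi_def)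
qed

lemma bij_betw_phi:
  assumes "r \<in> {0..5}"
  shows "bij_betw (phi k r) (P3 (6 * k + r)) (Q k r)"
proof -
  have "\<exists>\<mu> \<tau>. (\<mu>, \<tau>) \<in> Q k r \<and> v = \<mu> + V3 *v \<tau>" if "v \<in> P3 (6 * k + r)" for v
    using V3_mult_add_exists[OF that] mem_Q_iff[OF assms] that by metis
  then show ?thesis
    using phi_eq[OF assms] mem_Q_iff[OF assms]
    by (intro bij_betw_byWitness[where f' = "\<lambda>(\<mu>, \<tau>). \<mu> + V3 *v \<tau>"]) fastforce+
qed

text \<open>Disjointness of the images separates different pieces, injectivity of each
  \<open>\<psi> \<mu>\<close> separates points within one piece, and the union condition gives
  surjectivity.\<close>

lemma bij_betw_psiQ:
  assumes inj: "\<And>i \<mu> s. i \<in> {0, 1, 2} \<Longrightarrow> \<mu> \<in> H (r + 6 * i) \<Longrightarrow> s \<ge> 1 \<Longrightarrow> inj_on (\<psi> \<mu>) (T s)"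
    and disj: "disjoint_family_on (\<lambda>(i, \<mu>). \<psi> \<mu> ` T (k - i)) (SIGMA i:{0, 1, 2}. H (r + 6 * i))"
    and Un: "(\<Union>i\<in>{0, 1, 2}. \<Union>\<mu>\<in>H (r + 6 * i). \<psi> \<mu> ` T (k - i)) = R"
  shows "bij_betw (psiQ \<psi> k r) (Q k r) R"
proof -
  have Q: "(\<mu>, \<tau>) \<in> Q k r \<longleftrightarrow> (\<exists>i\<in>{0, 1, 2}. \<mu> \<in> H (r + 6 * i) \<and> \<tau> \<in> T (k - i))" for \<mu> \<tau>
    by (auto simp: Q_def add.commute)
  \<comment> \<open>Injectivity is given for \<open>s \<ge> 1\<close>; for smaller \<open>s\<close>
    it is automatic, because \<open>T s\<close> has at most one point.\<close>
  have T_nonpos: "T s \<subseteq> {0}" if "s \<le> 0" for s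
  proof
    fix v assume v: "v \<in> T s"
    have "(of_int s :: real) \<le> 0" using that by simp
    with v show "v \<in> {0}" by (auto simp: T_def vec_eq_iff forall_3)
  qed
  have inj': "inj_on (\<psi> \<mu>) (T s)" if "i \<in> {0, 1, 2}" "\<mu> \<in> H (r + 6 * i)" for i \<mu> s
  proof (cases "s \<ge> 1")
    case False
    then show ?thesis using T_nonpos[of s] by (auto simp: inj_on_def)
  qed (use inj that in blast)
  have "inj_on (\<lambda>(\<mu>, \<tau>). \<psi> \<mu> \<tau>) (Q k r)"
  proof (rule inj_onI, clarify)
    fix \<mu> \<tau> \<mu>' \<tau>'
    assume "(\<mu>, \<tau>) \<in> Q k r" "(\<mu>', \<tau>') \<in> Q k r" and eq: "\<psi> \<mu> \<tau> = \<psi> \<mu>' \<tau>'"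
    then obtain i j where ij: "i \<in> {0, 1, 2}" "\<mu> \<in> H (r + 6 * i)" "\<tau> \<in> T (k - i)"
      "j \<in> {0, 1, 2}" "\<mu>' \<in> H (r + 6 * j)" "\<tau>' \<in> T (k - j)"
      unfolding Q by metis
    have "(i, \<mu>) = (j, \<mu>')"
    proof (rule ccontr)
      assume "(i, \<mu>) \<noteq> (j, \<mu>')"
      with disj ij have "\<psi> \<mu> ` T (k - i) \<inter> \<psi> \<mu>' ` T (k - j) = {}"
        unfolding disjoint_family_on_def by fast
      with ij eq show False by auto
    qed
    with ij eq inj' show "\<mu> = \<mu>' \<and> \<tau> = \<tau>'"
      by (auto dest: inj_onD)
  qed
  moreover have "(\<lambda>(\<mu>, \<tau>). \<psi> \<mu> \<tau>) ` Q k r = R"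
  proof -
    have "(\<lambda>(\<mu>, \<tau>). \<psi> \<mu> \<tau>) ` Q k r = {\<psi> \<mu> \<tau> |\<mu> \<tau>. (\<mu>, \<tau>) \<in> Q k r}"
      by auto
    also have "\<dots> = R"
      unfolding Un[symmetric] Q by blast
    finally show ?thesis .
  qed
  ultimately show ?thesis
    unfolding psiQ_def bij_betw_def by (auto simp: inj_on_def)
qed

subsection \<open>Colour classes and cyclic shifts on an integer rectangle\<close>

text \<open>Coordinates on the rectangle by integer pairs, so that counting and \<open>mod\<close>
  take place in the integers rather than in \<open>real ^ 2\<close>.\<close>

definition int_point :: "int \<times> int \<Rightarrow> real ^ 2" where
  "int_point = (\<lambda>(x, y). vector [of_int x, of_int y])"

lemma bij_betw_int_point: "bij_betw int_point ({0..<a} \<times> {0..<b}) (rect a b)"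
proof -
  have "\<exists>p \<in> {0..<a} \<times> {0..<b}. int_point p = v" if v: "v \<in> rect a b" for v
  proof -
    from v have "v $ 1 \<in> \<int>" "v $ 2 \<in> \<int>" by (auto simp: rect_def int_lattice_def)
    then obtain x y where xy: "v $ 1 = of_int x" "v $ 2 = of_int y"
      by (auto elim!: Ints_cases)
    \<comment> \<open>Keeping the cast of \<open>a - 1\<close> in one piece lets the real bounds
      reduce directly to integer bounds.\<close>
    have "0 \<le> x \<and> x \<le> a - 1 \<and> 0 \<le> y \<and> y \<le> b - 1"
      using v unfolding rect_def by (simp add: xy del: of_int_diff)
    then show ?thesis
      using xy by (intro bexI[of _ "(x, y)"]) (auto simp: int_point_def vec_eq_iff forall_2)
  qed
  moreover have "int_point p \<in> rect a b" if "p \<in> {0..<a} \<times> {0..<b}" for p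
    using that by (auto simp: int_point_def rect_def int_lattice_def forall_2 simp del: of_int_diff)
  moreover have "inj int_point"
    by (auto simp: inj_def int_point_def vec_eq_iff forall_2)
  ultimately show ?thesis
    unfolding bij_betw_def by (auto simp: inj_on_def)
qed

text \<open>Invertibility of \<open>\<alpha>\<close> turns the condition into a single residue class
  for \<open>x\<close>, which meets each of the \<open>q\<close> consecutive blocks of length
  \<open>m\<close> exactly once.\<close>

lemma card_affine_residue_class:
  fixes \<alpha> c j m q :: int
  assumes "m \<ge> 1" "gcd \<alpha> m = 1" "j \<in> {0..m - 1}" "q \<ge> 0"
  shows "int (card {x \<in> {0..<m * q}. (\<alpha> * x + c) mod m = j}) = q"
proof -
  have "coprime \<alpha> m" using assms(2) by (simp add: coprime_iff_gcd_eq_1)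
  then obtain u where u: "[\<alpha> * u = 1] (mod m)"
    using cong_solve_coprime_int by blast
  \<comment> \<open>The least nonnegative solution, obtained by multiplying \<open>j - c\<close>
    with the inverse \<open>u\<close> of \<open>\<alpha>\<close>.\<close>
  define x0 where "x0 = (u * (j - c)) mod m"
  have "[\<alpha> * x0 = \<alpha> * u * (j - c)] (mod m)"
    unfolding x0_def cong_def by (simp add: mod_mult_right_eq mult.assoc)
  also have "[\<alpha> * u * (j - c) = 1 * (j - c)] (mod m)"
    by (rule cong_mult[OF u cong_refl])
  finally have x0: "[\<alpha> * x0 = j - c] (mod m)" by simp
  have iff: "(\<alpha> * x + c) mod m = j \<longleftrightarrow> x mod m = x0" for x
  proof -
    have "(\<alpha> * x + c) mod m = j \<longleftrightarrow> [\<alpha> * x + c = j] (mod m)"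
      using assms by (simp add: cong_def)
    also have "\<dots> \<longleftrightarrow> [\<alpha> * x = j - c] (mod m)"
      by (simp add: cong_iff_dvd_diff algebra_simps)
    also have "\<dots> \<longleftrightarrow> [\<alpha> * x = \<alpha> * x0] (mod m)"
      using x0 cong_sym cong_trans by blast
    also have "\<dots> \<longleftrightarrow> [x = x0] (mod m)"
      using \<open>coprime \<alpha> m\<close> by (rule cong_mult_lcancel)
    also have "\<dots> \<longleftrightarrow> x mod m = x0"
      by (simp add: cong_def x0_def)
    finally show ?thesis .
  qed
  have x0b: "0 \<le> x0" "x0 < m" using assms(1) by (simp_all add: x0_def)
  have "{x \<in> {0..<m * q}. (\<alpha> * x + c) mod m = j} = (\<lambda>t. x0 + m * t) ` {0..<q}"
  proof (intro set_eqI iffI)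
    fix x assume "x \<in> {x \<in> {0..<m * q}. (\<alpha> * x + c) mod m = j}"
    then have x: "0 \<le> x" "x < q * m" "x mod m = x0" by (auto simp: iff mult.commute)
    have "x div m < q" using x(2) assms(1) mod_mult_div_eq[of x m] x0b(1) x(3)
      by (smt (verit) mult.commute mult_right_less_imp_less)
    moreover have "0 \<le> x div m" using x(1) assms(1) by (simp add: pos_imp_zdiv_nonneg_iff)
    moreover have "x = x0 + m * (x div m)" using x(3) mod_mult_div_eq[of x m] by simp
    ultimately show "x \<in> (\<lambda>t. x0 + m * t) ` {0..<q}" by auto
  next
    fix x assume "x \<in> (\<lambda>t. x0 + m * t) ` {0..<q}"
    then obtain t where t: "x = x0 + m * t" "0 \<le> t" "t < q" unfolding image_iff by fastforce
    \<comment> \<open>Integrality of \<open>t\<close> leaves room for a whole block above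
      \<open>m * t\<close>, and \<open>x0 < m\<close> fits into it.\<close>
    have "m * (t + 1) \<le> m * q" using t assms(1) by (intro mult_left_mono) auto
    then have "x < m * q" using t x0b by (simp add: algebra_simps)
    moreover have "0 \<le> x" using t x0b assms(1) by simp
    moreover have "x mod m = x0" using t x0b by simp
    ultimately show "x \<in> {x \<in> {0..<m * q}. (\<alpha> * x + c) mod m = j}" by (simp add: iff)
  qed
  moreover have "inj_on (\<lambda>t. x0 + m * t) {0..<q}"
    using assms(1) by (auto simp: inj_on_def)
  ultimately show ?thesis
    using assms(4) by (simp add: card_image)
qed

text \<open>For fixed \<open>y\<close> the term \<open>\<beta> * y + \<gamma>\<close> is a constant,
  so every row contributes \<open>a\<close> divided by \<open>m\<close> points. For negative
  \<open>a\<close> the rectangle is empty.\<close>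

lemma card_colour_class_rectangle:
  fixes \<alpha> \<beta> \<gamma> j m a b :: int
  assumes "m \<ge> 1" "gcd \<alpha> m = 1" "m dvd a" "j \<in> {0..m - 1}"
  shows "m * int (card {(x, y) \<in> {0..<a} \<times> {0..<b}. (\<alpha> * x + \<beta> * y + \<gamma>) mod m = j}) =
    int (card ({0..<a} \<times> {0..<b}))"
proof (cases "a \<ge> 0")
  case True
  obtain q where q: "a = m * q" using assms(3) by blast
  with True assms(1) have "q \<ge> 0" by (simp add: zero_le_mult_iff)
  \<comment> \<open>Swapping makes \<open>y\<close> the outer index, so that the cardinality becomes
    a sum over rows.\<close>
  have "{(x, y) \<in> {0..<a} \<times> {0..<b}. (\<alpha> * x + \<beta> * y + \<gamma>) mod m = j} =
      prod.swap ` (SIGMA y:{0..<b}. {x \<in> {0..<m * q}. (\<alpha> * x + (\<beta> * y + \<gamma>)) mod m = j})"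
    by (auto simp: q image_iff add.assoc)
  then have "card {(x, y) \<in> {0..<a} \<times> {0..<b}. (\<alpha> * x + \<beta> * y + \<gamma>) mod m = j} =
      card (SIGMA y:{0..<b}. {x \<in> {0..<m * q}. (\<alpha> * x + (\<beta> * y + \<gamma>)) mod m = j})"
    by (simp only: card_image[OF inj_swap])
  then have "int (card {(x, y) \<in> {0..<a} \<times> {0..<b}. (\<alpha> * x + \<beta> * y + \<gamma>) mod m = j}) =
      (\<Sum>y\<in>{0..<b}. int (card {x \<in> {0..<m * q}. (\<alpha> * x + (\<beta> * y + \<gamma>)) mod m = j}))"
    by (subst (asm) card_SigmaI) (auto intro: finite_subset[of _ "{0..<m * q}"])
  also have "\<dots> = int (card {0..<b}) * q"
    using card_affine_residue_class[OF assms(1,2,4) \<open>q \<ge> 0\<close>] by simp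
  finally show ?thesis
    using True q by (simp add: card_cartesian_product)
qed simp

text \<open>The bijection \<open>g\<close> conjugates \<open>\<sigma>\<close> to adding 1 modulo
  \<open>a\<close> in the first coordinate, and the iterates of that rotation run through the whole
  line with \<open>y\<close> fixed.\<close>

lemma permutation_with_cycle_length_rotation:
  fixes g :: "int \<times> 'b \<Rightarrow> 'a"
  assumes g: "bij_betw g ({0..<a} \<times> Y) S"
    and \<sigma>: "\<And>x y. x \<in> {0..<a} \<Longrightarrow> y \<in> Y \<Longrightarrow> \<sigma> (g (x, y)) = g ((x + 1) mod a, y)"
  shows "permutation_with_cycle_length \<sigma> S a"
  unfolding permutation_with_cycle_length_def
proof
  define h where "h = (\<lambda>(x :: int, y :: 'b). ((x + 1) mod a, y))"
  have "bij_betw h ({0..<a} \<times> Y) ({0..<a} \<times> Y)"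
    by (rule bij_betw_byWitness[where f' = "\<lambda>(x, y). ((x - 1) mod a, y)"])
       (auto simp: h_def mod_simps)
  then have "bij_betw (g \<circ> h \<circ> inv_into ({0..<a} \<times> Y) g) S S"
    by (intro bij_betw_trans[OF bij_betw_inv_into[OF g]] bij_betw_trans[OF _ g])
  moreover have "(g \<circ> h \<circ> inv_into ({0..<a} \<times> Y) g) v = \<sigma> v" if "v \<in> S" for v
  proof -
    from that obtain x y where "x \<in> {0..<a}" "y \<in> Y" "v = g (x, y)"
      using bij_betw_imp_surj_on[OF g] by auto
    then show ?thesis
      using \<sigma> g by (simp add: h_def bij_betw_inv_into_left)
  qed
  ultimately show "bij_betw \<sigma> S S"
    using bij_betw_cong by blast
  show "\<forall>v\<in>S. int (card (orbit \<sigma> v)) = a"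
  proof
    fix v assume "v \<in> S"
    then obtain x y where v: "x \<in> {0..<a}" "y \<in> Y" "v = g (x, y)"
      using bij_betw_imp_surj_on[OF g] by auto
    have a: "a > 0" using v(1) by auto
    have pow: "(\<sigma> ^^ n) v = g ((x + int n) mod a, y)" for n
    proof (induction n)
      case (Suc n)
      then show ?case using a v(2) \<sigma>[of "(x + int n) mod a" y] by (simp add: mod_simps ac_simps)
    qed (use v in simp)
    have "orbit \<sigma> v = (\<lambda>z. g (z, y)) ` {0..<a}"
    proof (intro set_eqI iffI)
      fix w assume "w \<in> orbit \<sigma> v"
      then show "w \<in> (\<lambda>z. g (z, y)) ` {0..<a}"
        using a by (auto simp: orbit_altdef pow)
    next
      fix w assume "w \<in> (\<lambda>z. g (z, y)) ` {0..<a}"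
      then obtain z where z: "w = g (z, y)" "0 \<le> z" "z < a" by auto
      \<comment> \<open>The added \<open>a\<close> keeps the exponent positive, as
        \<open>orbit\<close> requires at least one application; for \<open>z = x\<close> it is one
        full turn.\<close>
      have "(x + int (nat (z - x + a))) mod a = z"
        using z v(1) by simp
      moreover have "0 < nat (z - x + a)" using z v(1) by simp
      ultimately have "w = (\<sigma> ^^ nat (z - x + a)) v \<and> 0 < nat (z - x + a)"
        using z by (simp only: pow)
      then show "w \<in> orbit \<sigma> v" unfolding orbit_altdef by blast
    qed
    moreover have "inj_on (\<lambda>z. g (z, y)) {0..<a}"
      using bij_betw_imp_inj_on[OF g] v(2) by (auto simp: inj_on_def)
    ultimately show "int (card (orbit \<sigma> v)) = a"
      using a by (simp add: card_image)
  qed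
qed

section \<open>Transfer from the integer grid, where \<open>rmod\<close> becomes \<open>mod\<close>,
  back to the partitions\<close>

lemma rmod_of_int:
  assumes "a > 0"
  shows "of_int x rmod of_int a = of_int (x mod a)"
proof (rule rmod_unique)
  have "of_int x = of_int (x mod a + a * (x div a))" by simp
  then show "of_int x = of_int (x mod a) + of_int (x div a) * (of_int a :: real)"
    by (simp only: of_int_add of_int_mult mult.commute)
qed (use assms in auto)

lemma cyclic_add_int_point:
  assumes "a > 0" "b > 0"
  shows "cyclic_add a b (int_point (x, y)) (int_point (u, v)) = int_point ((x + u) mod a, (y + v) mod b)"
  using assms by (simp add: cyclic_add_def int_point_def rmod_of_int flip: of_int_add)

text \<open>In the grid coordinates given by \<open>g\<close>, the shift is translation modulo the
  side lengths. The first direction is a rotation as it stands, the second one after exchanging the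
  coordinates.\<close>

lemma shift_by_cycles:
  assumes f: "bij_betw f S (rect a b)"
  shows "permutation_with_cycle_length (shift_by S f a b (vector [1, 0])) S a" (is ?fst)
    and "permutation_with_cycle_length (shift_by S f a b (vector [0, 1])) S b" (is ?snd)
proof -
  define g where "g = inv_into S f \<circ> int_point"
  have g: "bij_betw g ({0..<a} \<times> {0..<b}) S"
    unfolding g_def by (rule bij_betw_trans[OF bij_betw_int_point bij_betw_inv_into[OF f]])
  have fg: "f (g p) = int_point p" if "p \<in> {0..<a} \<times> {0..<b}" for p
    using that bij_betw_inv_into_right[OF f] bij_betwE[OF bij_betw_int_point] by (auto simp: g_def)
  have d: "vector [1, 0] = int_point (1, 0)" "vector [0, 1] = int_point (0, 1)"
    by (simp_all add: int_point_def)
  have shift: "shift_by S f a b (int_point (u, v)) (g (x, y)) = g ((x + u) mod a, (y + v) mod b)"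
    if "x \<in> {0..<a}" "y \<in> {0..<b}" for x y u v
    \<comment> \<open>\<open>g\<close> is unfolded only after \<open>fg\<close> has evaluated
      \<open>f (g (x, y))\<close>.\<close>
    using that by (simp add: shift_by_def fg cyclic_add_int_point) (simp add: g_def)
  show ?fst
    unfolding d by (rule permutation_with_cycle_length_rotation[OF g]) (simp add: shift)
  have "bij_betw (g \<circ> prod.swap) ({0..<b} \<times> {0..<a}) S"
    by (rule bij_betw_trans[OF _ g]) (auto simp: bij_betw_def product_swap)
  then show ?snd
    unfolding d by (rule permutation_with_cycle_length_rotation) (simp add: shift)
qed

text \<open>The parametrization \<open>g\<close> carries colour classes to residue classes on the
  grid. The second alternative follows from the first by exchanging the axes together with
  \<open>\<alpha>\<close> and \<open>\<beta>\<close>.\<close>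

lemma card_colour_class:
  fixes m \<alpha> \<beta> \<gamma> a b j :: int
  assumes f: "bij_betw f S (rect a b)"
    and \<eta>: "\<And>x y :: int. \<eta> (vector [of_int x, of_int y]) = (\<alpha> * x + \<beta> * y + \<gamma>) mod m"
    and "m \<ge> 1" "gcd \<alpha> m = 1 \<and> m dvd a \<or> gcd \<beta> m = 1 \<and> m dvd b" "j \<in> {0..m - 1}"
  shows "m * int (card {v \<in> S. \<eta> (f v) = j}) = int (card S)"
proof -
  let ?R = "{0..<a} \<times> {0..<b}"
  define g where "g = inv_into S f \<circ> int_point"
  have g: "bij_betw g ?R S"
    unfolding g_def by (rule bij_betw_trans[OF bij_betw_int_point bij_betw_inv_into[OF f]])
  have fg: "f (g p) = int_point p" if "p \<in> ?R" for p
    using that bij_betw_inv_into_right[OF f] bij_betwE[OF bij_betw_int_point] by (auto simp: g_def)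
  have "\<eta> (f (g (x, y))) = (\<alpha> * x + \<beta> * y + \<gamma>) mod m" if "(x, y) \<in> ?R" for x y
    using fg[OF that] \<eta> by (simp add: int_point_def)
  then have "{v \<in> S. \<eta> (f v) = j} = g ` {(x, y) \<in> ?R. (\<alpha> * x + \<beta> * y + \<gamma>) mod m = j}"
    unfolding bij_betw_imp_surj_on[OF g, symmetric] by force
  moreover have "inj_on g {(x, y) \<in> ?R. (\<alpha> * x + \<beta> * y + \<gamma>) mod m = j}"
    by (rule inj_on_subset[OF bij_betw_imp_inj_on[OF g]]) auto
  ultimately have c: "card {v \<in> S. \<eta> (f v) = j} =
      card {(x, y) \<in> ?R. (\<alpha> * x + \<beta> * y + \<gamma>) mod m = j}"
    by (simp add: card_image)
  have "m * int (card {(x, y) \<in> ?R. (\<alpha> * x + \<beta> * y + \<gamma>) mod m = j}) = int (card ?R)"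
    using assms(4)
  proof
    assume "gcd \<alpha> m = 1 \<and> m dvd a"
    with assms(3,5) show ?thesis by (intro card_colour_class_rectangle) simp_all
  next
    assume *: "gcd \<beta> m = 1 \<and> m dvd b"
    have "{(x, y) \<in> ?R. (\<alpha> * x + \<beta> * y + \<gamma>) mod m = j} =
        prod.swap ` {(y, x) \<in> {0..<b} \<times> {0..<a}. (\<beta> * y + \<alpha> * x + \<gamma>) mod m = j}"
      by (auto simp: image_iff add.commute)
    then show ?thesis
      using card_colour_class_rectangle[of m \<beta> b j a \<alpha> \<gamma>] * assms(3,5)
      by (simp add: card_image card_cartesian_product mult.commute)
  qed
  then show ?thesis
    using bij_betw_same_card[OF g] c by simp
qed

theorem theorem3:
  fixes m r' r \<alpha> \<beta> \<gamma> :: int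
    and k l1 l2 :: "int \<Rightarrow> int"
    and \<psi> :: "real ^ 3 \<Rightarrow> real ^ 3 \<Rightarrow> real ^ 2"
    and \<eta> :: "real ^ 2 \<Rightarrow> int"
  assumes "m \<ge> 1" and "r' \<ge> 0" and "r \<in> {0..5}"
    and "\<And>k'. k' \<ge> 0 \<Longrightarrow> 6 * m * k' + r' = 6 * k k' + r"
    and "\<And>i \<mu>. i \<in> {0, 1, 2} \<Longrightarrow> \<mu> \<in> H (r + 6 * i) \<Longrightarrow> affine_map (\<psi> \<mu>)"
    and "\<And>i \<mu> s. i \<in> {0, 1, 2} \<Longrightarrow> \<mu> \<in> H (r + 6 * i) \<Longrightarrow> s \<ge> 1 \<Longrightarrow> inj_on (\<psi> \<mu>) (T s)"
    and "\<And>k'. k' \<ge> 0 \<Longrightarrow>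
           disjoint_family_on (\<lambda>(i, \<mu>). \<psi> \<mu> ` T (k k' - i)) (SIGMA i:{0, 1, 2}. H (r + 6 * i))"
    and "\<And>k'. k' \<ge> 0 \<Longrightarrow>
           (\<Union>i\<in>{0, 1, 2}. \<Union>\<mu>\<in>H (r + 6 * i). \<psi> \<mu> ` T (k k' - i)) = rect (l1 k') (l2 k')"
    and "\<And>v. \<eta> v \<in> {0..m - 1}"
    and "\<And>x y :: int. \<eta> (vector [of_int x, of_int y]) = (\<alpha> * x + \<beta> * y + \<gamma>) mod m"
    and "(gcd \<alpha> m = 1 \<and> (\<forall>k'\<ge>0. m dvd l1 k')) \<or> (gcd \<beta> m = 1 \<and> (\<forall>k'\<ge>0. m dvd l2 k'))"
  shows "\<forall>k'\<ge>0.
    let n = 6 * m * k' + r';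
        f = psiQ \<psi> (k k') r \<circ> phi (k k') r;
        c = \<eta> \<circ> f
    in bij_betw f (P3 n) (rect (l1 k') (l2 k')) \<and>
       m dvd int (p3 n) \<and>
       (\<forall>j\<in>{0..m - 1}. real (card {v \<in> P3 n. c v = j}) = real (p3 n) / of_int m) \<and>
       (gcd \<alpha> m = 1 \<and> (\<forall>k'\<ge>0. m dvd l1 k') \<longrightarrow>
          permutation_with_cycle_length
            (shift_by (P3 n) f (l1 k') (l2 k') (vector [1, 0])) (P3 n) (l1 k')) \<and>
       (gcd \<beta> m = 1 \<and> (\<forall>k'\<ge>0. m dvd l2 k') \<longrightarrow>
          permutation_with_cycle_length
            (shift_by (P3 n) f (l1 k') (l2 k') (vector [0, 1])) (P3 n) (l2 k'))"
proof (intro allI impI)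
  fix k' :: int
  assume k': "k' \<ge> 0"
  define n f where "n = 6 * m * k' + r'" and "f = psiQ \<psi> (k k') r \<circ> phi (k k') r"
  \<comment> \<open>The relation between \<open>k'\<close> and \<open>k k'\<close> identifies
    \<open>n\<close> with \<open>6 * k k' + r\<close>, the size of the partitions on which
    \<open>phi (k k') r\<close> is defined.\<close>
  have "bij_betw (phi (k k') r) (P3 n) (Q (k k') r)"
    using bij_betw_phi[OF assms(3)] assms(4)[OF k'] by (simp add: n_def)
  moreover have "bij_betw (psiQ \<psi> (k k') r) (Q (k k') r) (rect (l1 k') (l2 k'))"
    using assms(6) assms(7,8)[OF k'] by (rule bij_betw_psiQ)
  ultimately have f: "bij_betw f (P3 n) (rect (l1 k') (l2 k'))"
    unfolding f_def by (rule bij_betw_trans)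
  have count: "m * int (card {v \<in> P3 n. \<eta> (f v) = j}) = int (p3 n)" if "j \<in> {0..m - 1}" for j
    unfolding p3_def
    using f assms(10,1) _ that by (rule card_colour_class) (use assms(11) k' in blast)
  \<comment> \<open>Colour 0 is available because \<open>m \<ge> 1\<close>, and the size of its
    class is the cofactor.\<close>
  have "m dvd int (p3 n)"
    using dvdI[OF count[of 0, symmetric]] assms(1) by simp
  moreover have "real (card {v \<in> P3 n. (\<eta> \<circ> f) v = j}) = real (p3 n) / of_int m"
    if "j \<in> {0..m - 1}" for j
  proof -
    have "of_int m * real (card {v \<in> P3 n. \<eta> (f v) = j}) = real (p3 n)"
      using arg_cong[OF count[OF that], of real_of_int] by simp
    then show ?thesis using assms(1) by (simp add: field_simps)
  qed
  ultimately show "let n = 6 * m * k' + r';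
        f = psiQ \<psi> (k k') r \<circ> phi (k k') r;
        c = \<eta> \<circ> f
    in bij_betw f (P3 n) (rect (l1 k') (l2 k')) \<and>
       m dvd int (p3 n) \<and>
       (\<forall>j\<in>{0..m - 1}. real (card {v \<in> P3 n. c v = j}) = real (p3 n) / of_int m) \<and>
       (gcd \<alpha> m = 1 \<and> (\<forall>k'\<ge>0. m dvd l1 k') \<longrightarrow>
          permutation_with_cycle_length
            (shift_by (P3 n) f (l1 k') (l2 k') (vector [1, 0])) (P3 n) (l1 k')) \<and>
       (gcd \<beta> m = 1 \<and> (\<forall>k'\<ge>0. m dvd l2 k') \<longrightarrow>
          permutation_with_cycle_length
            (shift_by (P3 n) f (l1 k') (l2 k') (vector [0, 1])) (P3 n) (l2 k'))"
    unfolding Let_def n_def[symmetric] f_def[symmetric]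
    using f shift_by_cycles[OF f] by blast
qed

end
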